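(* Let $S$ be a finite generating set of the restricted wreath product $\mathbb Z\wr\mathbb Z$. There exists a constant $c>0$ such that for all integers $n\ge1$, $$\mathrm{Rf}_{\mathbb Z\wr\mathbb Z,S}(n)\le c\,n^2.$$
   Context: For a residually finite group $G$ with finite generating set $S$ and word norm $\|\cdot\|_S$ (the least number of factors in $S\cup S^{-1}$ needed to write an element), the residual finiteness growth function is, for $n\ge1$, $$\mathrm{Rf}_{G,S}(n)=\max_{g\in G\setminus\{1\},\ \|g\|_S\le n}\ \min\{|Q| : \varphi:G\to Q \text{ a homomorphism to a finite group},\ \varphi(g)\ne1\}$$ (maximum over the empty set is $0$). $\mathbb Z\wr\mathbb Z=\left(\bigoplus_{\mathbb Z}\mathbb Z\right)\rtimes\mathbb Z$ with $\mathbb Z$ acting by shifting; it is residually finite. *)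

theory Defs
  imports "HOL-Algebra.Algebra" "HOL-Algebra.Product_Groups" "HOL-Algebra.Elementary_Groups"
    Complex_Main
begin

definition semidirect_product ::
  "('a, 'm) monoid_scheme \<Rightarrow> ('b, 'n) monoid_scheme \<Rightarrow> ('b \<Rightarrow> 'a \<Rightarrow> 'a) \<Rightarrow> ('a \<times> 'b) monoid"
  where "semidirect_product N H act =
    \<lparr>carrier = carrier N \<times> carrier H,
     monoid.mult = (\<lambda>(x, s) (y, t). (x \<otimes>\<^bsub>N\<^esub> act s y, s \<otimes>\<^bsub>H\<^esub> t)),
     one = (\<one>\<^bsub>N\<^esub>, \<one>\<^bsub>H\<^esub>)\<rparr>"

definition Z_wr_Z :: "((int \<Rightarrow> int) \<times> int) monoid"
  where "Z_wr_Z = semidirect_product (sum_group UNIV (\<lambda>_. integer_group)) integer_group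
    (\<lambda>s f i. f (i - s))"

definition generating_set :: "('a, 'm) monoid_scheme \<Rightarrow> 'a set \<Rightarrow> bool"
  where "generating_set G S \<longleftrightarrow> S \<subseteq> carrier G \<and> generate G S = carrier G"

definition word_product :: "('a, 'm) monoid_scheme \<Rightarrow> 'a list \<Rightarrow> 'a"
  where "word_product G ws = foldr (\<otimes>\<^bsub>G\<^esub>) ws \<one>\<^bsub>G\<^esub>"

definition word_norm :: "('a, 'm) monoid_scheme \<Rightarrow> 'a set \<Rightarrow> 'a \<Rightarrow> nat"
  where "word_norm G S g = (LEAST k. \<exists>ws. length ws = k \<and>
    set ws \<subseteq> S \<union> m_inv G ` S \<and> word_product G ws = g)"

text \<open>
  The orders of the finite groups in which the image of g is nontrivial. The finite groups are
  taken with carrier contained in the natural numbers; up to isomorphism these are all finite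
  groups, and \<open>detecting_ordersI\<close> below shows that groups over any other type give the same orders.
\<close>

definition detecting_orders :: "('a, 'm) monoid_scheme \<Rightarrow> 'a \<Rightarrow> nat set"
  where "detecting_orders G g = {order Q | (Q :: nat monoid) \<phi>.
    group Q \<and> finite (carrier Q) \<and> \<phi> \<in> hom G Q \<and> \<phi> g \<noteq> \<one>\<^bsub>Q\<^esub>}"

text \<open>
  The set of orders may be infinite, so its minimum is written with \<open>LEAST\<close>; it is nonempty for
  every nontrivial g exactly when G is residually finite. Inserting 0 only affects the
  maximum over the empty set.
\<close>

definition Rf :: "('a, 'm) monoid_scheme \<Rightarrow> 'a set \<Rightarrow> nat \<Rightarrow> nat"
  where "Rf G S n = Max (insert 0
    ((\<lambda>g. LEAST q. q \<in> detecting_orders G g) `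
       {g \<in> carrier G - {\<one>\<^bsub>G\<^esub>}. word_norm G S g \<le> n}))"

lemma detecting_ordersI:
  fixes Q :: "('b, 'k) monoid_scheme"
  assumes Q: "group Q" and fin: "finite (carrier Q)" and \<phi>: "\<phi> \<in> hom G Q"
    and g: "g \<in> carrier G" "\<phi> g \<noteq> \<one>\<^bsub>Q\<^esub>"
  shows "order Q \<in> detecting_orders G g"
proof -
  interpret Q: group Q by fact
  obtain f :: "'b \<Rightarrow> nat" where f: "inj_on f (carrier Q)"
    using finite_imp_inj_to_nat_seg[OF fin] by blast
  define h where "h = inv_into (carrier Q) f"
  have h: "h (f x) = x" if "x \<in> carrier Q" for x
    unfolding h_def using f that by simp
  define P where "P = \<lparr>carrier = f ` carrier Q,
    monoid.mult = (\<lambda>x y. f (h x \<otimes>\<^bsub>Q\<^esub> h y)), one = f \<one>\<^bsub>Q\<^esub>\<rparr>"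
  have "group P"
  proof (rule groupI)
    fix x assume "x \<in> carrier P"
    then obtain a where a: "a \<in> carrier Q" "x = f a" by (auto simp: P_def)
    show "\<exists>y\<in>carrier P. y \<otimes>\<^bsub>P\<^esub> x = \<one>\<^bsub>P\<^esub>"
      by (rule bexI[of _ "f (inv\<^bsub>Q\<^esub> a)"]) (use a in \<open>auto simp: P_def h\<close>)
  qed (auto simp: P_def h Q.m_assoc)
  moreover have "finite (carrier P)" using fin by (simp add: P_def)
  moreover have "f \<circ> \<phi> \<in> hom G P"
    using \<phi> by (auto simp: hom_def P_def h Pi_iff)
  moreover have "(f \<circ> \<phi>) g \<noteq> \<one>\<^bsub>P\<^esub>"
    using inj_onD[OF f, of "\<phi> g" "\<one>\<^bsub>Q\<^esub>"] \<phi> g by (auto simp: P_def hom_def Pi_iff)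
  moreover have "order P = order Q"
    using f by (simp add: order_def P_def card_image)
  ultimately show ?thesis
    unfolding detecting_orders_def by (intro CollectI exI[of _ P] exI[of _ "f \<circ> \<phi>"]) auto
qed

lemma carrier_Z_wr_Z: "carrier Z_wr_Z = {f. finite {i. f i \<noteq> 0}} \<times> UNIV"
  by (auto simp: Z_wr_Z_def semidirect_product_def carrier_sum_group)

lemma mult_Z_wr_Z: "(f, s) \<otimes>\<^bsub>Z_wr_Z\<^esub> (g, t) = (\<lambda>i. f i + g (i - s), s + t)"
  by (auto simp: Z_wr_Z_def semidirect_product_def)

lemma one_Z_wr_Z: "\<one>\<^bsub>Z_wr_Z\<^esub> = (\<lambda>_. 0, 0)"
  by (auto simp: Z_wr_Z_def semidirect_product_def)

lemma finite_support_shift: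
  fixes f :: "int \<Rightarrow> int"
  assumes "finite {i. f i \<noteq> 0}"
  shows "finite {i. f (i - s) \<noteq> 0}"
proof -
  have "{i. f (i - s) \<noteq> 0} = (\<lambda>i. i + s) ` {i. f i \<noteq> 0}"
    by (auto simp: image_iff) (metis diff_add_cancel)
  then show ?thesis using assms by simp
qed

lemma group_Z_wr_Z: "group Z_wr_Z"
proof (rule groupI)
  fix x y assume x: "x \<in> carrier Z_wr_Z" and y: "y \<in> carrier Z_wr_Z"
  obtain f s g t where [simp]: "x = (f, s)" "y = (g, t)" by (metis surj_pair)
  have "finite ({i. f i \<noteq> 0} \<union> {i. g (i - s) \<noteq> 0})"
    using x y finite_support_shift by (simp add: carrier_Z_wr_Z)
  then have "finite {i. f i + g (i - s) \<noteq> 0}"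
    by (rule rev_finite_subset) auto
  then show "x \<otimes>\<^bsub>Z_wr_Z\<^esub> y \<in> carrier Z_wr_Z"
    by (simp add: carrier_Z_wr_Z mult_Z_wr_Z)
next
  fix x assume x: "x \<in> carrier Z_wr_Z"
  obtain f s where [simp]: "x = (f, s)" by (metis surj_pair)
  have "finite {i. f (i - (- s)) \<noteq> 0}"
    using x by (intro finite_support_shift) (simp add: carrier_Z_wr_Z)
  then show "\<exists>y\<in>carrier Z_wr_Z. y \<otimes>\<^bsub>Z_wr_Z\<^esub> x = \<one>\<^bsub>Z_wr_Z\<^esub>"
    by (intro bexI[of _ "(\<lambda>i. - f (i + s), - s)"])
      (auto simp: carrier_Z_wr_Z mult_Z_wr_Z one_Z_wr_Z)
qed (auto simp: carrier_Z_wr_Z mult_Z_wr_Z one_Z_wr_Z algebra_simps)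

lemma generating_set_word_exists:
  assumes G: "group G" and S: "generating_set G S" and g: "g \<in> carrier G"
  shows "\<exists>ws. set ws \<subseteq> S \<union> m_inv G ` S \<and> word_product G ws = g"
proof -
  interpret group G by fact
  define T where "T = S \<union> m_inv G ` S"
  have T: "T \<subseteq> carrier G" using S by (auto simp: T_def generating_set_def)
  have ST: "S \<subseteq> T" "m_inv G ` S \<subseteq> T" by (auto simp: T_def)
  have closed: "word_product G ws \<in> carrier G" if "set ws \<subseteq> T" for ws
    using that
  proof (induction ws)
    case Nil
    show ?case by (simp add: word_product_def)
  next
    case (Cons a ws)
    then have "a \<in> carrier G" "word_product G ws \<in> carrier G" using T by auto
    then show ?case by (simp add: word_product_def)
  qed
  have app: "word_product G (us @ vs) = word_product G us \<otimes>\<^bsub>G\<^esub> word_product G vs"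
    if "set us \<subseteq> T" "set vs \<subseteq> T" for us vs
    using that(1)
  proof (induction us)
    case Nil
    then show ?case using closed[OF that(2)] by (simp add: word_product_def)
  next
    case (Cons u us)
    then have u: "u \<in> carrier G" and us: "set us \<subseteq> T" using T by auto
    show ?case
      using Cons.IH[OF us] m_assoc[OF u closed[OF us] closed[OF that(2)]]
      by (simp add: word_product_def)
  qed
  have "g \<in> generate G S" using S g by (simp add: generating_set_def)
  then have "\<exists>ws. set ws \<subseteq> T \<and> word_product G ws = g"
  proof (induction rule: generate.induct)
    case one
    show ?case by (rule exI[of _ "[]"]) (simp add: word_product_def)
  next
    case (incl h)
    then have "h \<in> T" "h \<in> carrier G" using T ST by blast+
    then show ?case by (intro exI[of _ "[h]"]) (simp add: word_product_def)
  next
    case (inv h)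
    then have "inv\<^bsub>G\<^esub> h \<in> T" "inv\<^bsub>G\<^esub> h \<in> carrier G" using T ST by blast+
    then show ?case by (intro exI[of _ "[inv\<^bsub>G\<^esub> h]"]) (simp add: word_product_def)
  next
    case (eng h k)
    from eng.IH obtain us vs where us: "set us \<subseteq> T" "word_product G us = h"
      and vs: "set vs \<subseteq> T" "word_product G vs = k" by (elim exE conjE)
    then show ?case using app[OF us(1) vs(1)] by (intro exI[of _ "us @ vs"]) simp
  qed
  then show ?thesis by (simp add: T_def)
qed

lemma finite_word_norm_ball:
  assumes G: "group G" and S: "generating_set G S" "finite S"
  shows "finite {g \<in> carrier G. word_norm G S g \<le> n}"
proof -
  let ?T = "S \<union> m_inv G ` S"
  have "finite {ws. set ws \<subseteq> ?T \<and> length ws \<le> n}"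
    using S by (intro finite_lists_length_le) auto
  moreover have "{g \<in> carrier G. word_norm G S g \<le> n}
      \<subseteq> word_product G ` {ws. set ws \<subseteq> ?T \<and> length ws \<le> n}"
  proof
    fix g assume g: "g \<in> {g \<in> carrier G. word_norm G S g \<le> n}"
    then have "\<exists>k ws. length ws = k \<and> set ws \<subseteq> ?T \<and> word_product G ws = g"
      using generating_set_word_exists[OF G S(1)] by blast
    then have "\<exists>ws. length ws = word_norm G S g \<and> set ws \<subseteq> ?T \<and> word_product G ws = g"
      unfolding word_norm_def by (rule LeastI_ex)
    then show "g \<in> word_product G ` {ws. set ws \<subseteq> ?T \<and> length ws \<le> n}"
      using g by (metis (mono_tags, lifting) imageI mem_Collect_eq)
  qed
  ultimately show ?thesis using finite_subset[OF _ finite_imageI] by blast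
qed

end

theory Submission
  imports Defs "HOL-Number_Theory.Residues" "HOL-Computational_Algebra.Polynomial"
begin

text \<open>
  An element of the wreath product is a pair of a Laurent polynomial \<open>f\<close> with integer coefficients
  and a shift \<open>s\<close>. For an element of word norm at most \<open>n\<close>, the shift, the exponents occurring in
  \<open>f\<close> and the coefficients of \<open>f\<close> are bounded by \<open>B = n * C\<close>, where \<open>C\<close> depends only on the
  generating set (\<open>in_box_word_norm\<close>). It suffices to detect such an element in a group of order
  \<open>O(n\<^sup>2)\<close>.

  If \<open>s\<close> is not 0, then projecting to the shift modulo \<open>\<bar>s\<bar> + 1\<close> detects the element in a
  group of linear order (\<open>shift_detecting_order\<close>). If \<open>s = 0\<close>, then \<open>f\<close> is nonzero. For a prime \<open>p\<close>
  and a unit \<open>a\<close> modulo \<open>p\<close>, evaluating Laurent polynomials at \<open>a\<close> extends to a homomorphism from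
  the wreath product to a group of order \<open>p * (p - 1)\<close> acting by affine maps on the field with
  \<open>p\<close> elements (\<open>evaluate_hom\<close>). Once \<open>p\<close> exceeds \<open>2 * B + 1\<close>, the polynomial stays nonzero
  modulo \<open>p\<close> and has fewer roots than there are units, so some \<open>a\<close> satisfies \<open>f(a) \<noteq> 0\<close> modulo \<open>p\<close>
  (\<open>exists_unit_evaluate_nonzero\<close>).

  The bound is quadratic, without a logarithmic factor, because \<open>p\<close> can be chosen of size \<open>O(B)\<close>:
  between \<open>N\<close> and a constant multiple of \<open>N\<close> there is always a prime
  (\<open>prime_within_constant_factor\<close>). This is proved following Chebyshev, by comparing a lower
  bound for the least common multiple of \<open>{1..M}\<close>, obtained from binomial coefficients, with an
  upper bound for the product of the primes up to \<open>N\<close>.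
\<close>

hide_const (open) Divisibility.prime Polynomial.order

section \<open>Primes in intervals of bounded ratio\<close>

lemma prod_primes_dvd:
  fixes n :: nat
  assumes "finite A" "\<And>p. p \<in> A \<Longrightarrow> prime p" "\<And>p. p \<in> A \<Longrightarrow> p dvd n"
  shows "\<Prod>A dvd n"
proof -
  have "[n = 0] (mod (\<Prod>p\<in>A. p))"
    using assms by (intro cong_cong_prod_coprime_nat) (auto simp: cong_0_iff primes_coprime)
  then show ?thesis by (simp add: cong_0_iff)
qed

text \<open>
  The numbers \<open>1 / (k * (n choose k))\<close> form Leibniz's harmonic triangle, in which each entry is the
  difference of two entries of the previous column:
  \<open>1 / ((k + 1) * (m + 1 choose k + 1)) = 1 / (k * (m choose k)) - 1 / (k * (m + 1 choose k))\<close>.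
  The first column consists of the unit fractions \<open>1 / n\<close>, so a number \<open>D\<close> that clears the
  denominators of these clears the denominators of all entries.
\<close>

lemma leibniz_triangle_dvd:
  fixes D M :: nat
  assumes D: "\<And>m. 1 \<le> m \<Longrightarrow> m \<le> M \<Longrightarrow> m dvd D"
    and "1 \<le> k" "k \<le> n" "n \<le> M"
  shows "k * (n choose k) dvd D"
  using assms(2-4)
proof (induction k arbitrary: n rule: nat_induct_at_least)
  case base
  then show ?case using D by simp
next
  case (Suc k)
  then obtain m where n: "n = Suc m" "k \<le> m" by (cases n) auto
  have "k * (m choose k) dvd D" "k * (n choose k) dvd D"
    using Suc.prems n by (auto intro!: Suc.IH)
  then obtain a b where a: "D = k * (m choose k) * a" and b: "D = k * (n choose k) * b"
    unfolding dvd_def by blast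
  have 1: "Suc k * (n choose Suc k) = Suc m * (m choose k)"
    using Suc_times_binomial n by simp
  have 2: "(n - k) * (n choose k) = Suc m * (m choose k)"
    using binomial_absorb_comp[of n k] n by simp
  define u where "u = int (m choose k)"
  have u: "u > 0" using n by (simp add: u_def)
  have k: "int k > 0" using Suc.hyps by simp
  have a': "int D = int k * u * int a" by (simp add: a u_def)
  have "int (n - k) * int (n choose k) = int (Suc m) * u"
    using arg_cong[OF 2, of int] unfolding u_def by (simp only: of_nat_mult)
  then have "(int n - int k) * int (n choose k) = (int m + 1) * u"
    using n by simp
  moreover have "(int n - int k) * int D = int k * ((int n - int k) * int (n choose k)) * int b"
    by (simp add: b)
  ultimately have b': "(int n - int k) * int D = int k * ((int m + 1) * u) * int b"
    by (simp only:)
  have "int k * u * ((int n - int k) * int a) = int k * u * ((int m + 1) * int b)"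
    using a' b' by (simp add: ac_simps)
  then have "(int n - int k) * int a = (int m + 1) * int b"
    using u k by simp
  then have "int k * int a = (int m + 1) * (int a - int b)"
    using n by (simp add: algebra_simps)
  then have "int D = (int m + 1) * u * (int a - int b)"
    unfolding a' by (metis mult.assoc mult.commute)
  moreover have "int (Suc m * (m choose k)) = (int m + 1) * u"
    by (simp add: u_def algebra_simps)
  ultimately have "int (Suc m * (m choose k)) dvd int D"
    by simp
  then show ?case using 1 by (metis of_nat_dvd_iff)
qed

text \<open>
  Common multiples of initial segments are exponentially large because they absorb a central
  binomial coefficient. This replaces the usual computation of the prime factorisation of
  \<open>2 * n choose n\<close> by Legendre's formula.
\<close>

lemma two_power_le_common_multiple:
  fixes D M :: nat
  assumes "\<And>m. 1 \<le> m \<Longrightarrow> m \<le> 2 * n \<Longrightarrow> m dvd D" "D > 0" "n \<ge> 1"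
  shows "4 ^ n \<le> 2 * D"
proof -
  have "n * (2 * n choose n) dvd D"
    by (rule leibniz_triangle_dvd[where M = "2 * n"]) (use assms in auto)
  then have "n * (2 * n choose n) \<le> D" using assms(2) dvd_imp_le by blast
  moreover have "real (4 ^ n) \<le> real (2 * (n * (2 * n choose n)))"
    using central_binomial_lower_bound[of n] assms(3) by (simp add: field_simps)
  ultimately show ?thesis unfolding of_nat_le_iff by linarith
qed

text \<open>
  Chebyshev's upper bound: the primes in \<open>{N<..2 * N}\<close> all divide \<open>2 * N choose N \<le> 4 ^ N\<close>, and
  doubling \<open>N\<close> squares the bound. Powers of two let the induction proceed by doubling.
\<close>

lemma prod_primes_le_dyadic:
  "\<Prod>{p::nat. prime p \<and> p \<le> 2 ^ j} \<le> 4 ^ (2 ^ j)"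
proof (induction j)
  case 0
  have *: "{p::nat. prime p \<and> p \<le> 2 ^ 0} = {}"
    by (auto dest: prime_ge_2_nat)
  show ?case by (subst *) simp
next
  case (Suc j)
  define N :: nat where "N = 2 ^ j"
  let ?A = "{p. prime p \<and> p \<le> N}"
  let ?B = "{p. prime p \<and> N < p \<and> p \<le> 2 * N}"
  have "p dvd (2 * N choose N)" if p: "p \<in> ?B" for p
  proof -
    have "fact N * fact N * (2 * N choose N) = (fact (2 * N) :: nat)"
      using binomial_fact_lemma[of N "2 * N"] by (simp add: ac_simps)
    then have "p dvd fact N * fact N * (2 * N choose N)"
      using p prime_dvd_fact_iff[of p "2 * N"] by simp
    then show ?thesis
      using p by (auto simp: prime_dvd_mult_iff prime_dvd_fact_iff)
  qed
  then have "\<Prod>?B dvd (2 * N choose N)"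
    by (intro prod_primes_dvd) auto
  then have "\<Prod>?B \<le> (2 * N choose N)" by (rule dvd_imp_le) simp
  also have "\<dots> \<le> 2 ^ (2 * N)" by (rule binomial_le_pow2)
  finally have B: "\<Prod>?B \<le> 4 ^ N" by (simp add: power_mult)
  have "{p. prime p \<and> p \<le> 2 ^ Suc j} = ?A \<union> ?B"
    by (auto simp: N_def)
  then have "\<Prod>{p. prime p \<and> p \<le> 2 ^ Suc j} = \<Prod>?A * \<Prod>?B"
    by (simp add: prod.union_disjoint disjoint_iff)
  also have "\<dots> \<le> 4 ^ N * 4 ^ N"
    using Suc B by (intro mult_mono) (auto simp: N_def)
  finally show ?case by (simp add: N_def mult_2 flip: power_add)
qed

text \<open>
  If there are no primes between \<open>N\<close> and \<open>r\<^sup>2\<close>, then the least common multiple of \<open>{1..r\<^sup>2}\<close> is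
  small: a prime power occurring in it is at most \<open>r\<^sup>2\<close>, the exponent exceeds 1 only for the at
  most \<open>r\<close> primes up to the square root \<open>r\<close>, and the remaining factor is a product of distinct
  primes up to \<open>N\<close>.
\<close>

lemma smooth_common_multiple:
  fixes r :: nat
  assumes r: "r \<ge> 1" and gap: "\<And>p. prime p \<Longrightarrow> p \<le> r\<^sup>2 \<Longrightarrow> p \<le> N"
  obtains D where "D > 0" "\<And>m. 1 \<le> m \<Longrightarrow> m \<le> r\<^sup>2 \<Longrightarrow> m dvd D"
    "D \<le> (r\<^sup>2) ^ r * \<Prod>{p. prime p \<and> p \<le> N}"
proof
  \<comment> \<open>The exponent of \<open>p\<close> in the least common multiple of \<open>{1..r\<^sup>2}\<close>.\<close>
  define e where "e p = Max (multiplicity p ` {1..r\<^sup>2})" for p :: nat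
  define P where "P = {p::nat. prime p \<and> p \<le> r\<^sup>2}"
  define D where "D = (\<Prod>p\<in>P. p ^ e p)"
  have finP: "finite P" by (simp add: P_def)
  have pos: "p > 0" if "p \<in> P" for p using that by (simp add: P_def prime_gt_0_nat)
  show D0: "D > 0" unfolding D_def by (rule prod_pos) (simp add: pos)
  have ne: "multiplicity p ` {1..r\<^sup>2} \<noteq> {}" for p using r by auto
  have pow_le: "p ^ e p \<le> r\<^sup>2" for p
  proof -
    have "e p \<in> multiplicity p ` {1..r\<^sup>2}" unfolding e_def using ne by (intro Max_in) auto
    then obtain m where m: "m \<in> {1..r\<^sup>2}" "e p = multiplicity p m" by auto
    have "p ^ multiplicity p m dvd m" by (rule multiplicity_dvd)
    then show ?thesis using m by (auto dest!: dvd_imp_le)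
  qed
  show "m dvd D" if m: "1 \<le> m" "m \<le> r\<^sup>2" for m
  proof (rule multiplicity_le_imp_dvd)
    fix p :: nat assume p: "prime p"
    have mult: "multiplicity p D = (if p \<in> P then e p else 0)"
      unfolding D_def using finP p by (intro multiplicity_prod_prime_powers) (auto simp: P_def)
    show "multiplicity p m \<le> multiplicity p D"
    proof (cases "p \<in> P")
      case True
      have "multiplicity p m \<le> e p" unfolding e_def using m by (intro Max_ge) auto
      then show ?thesis using mult True by simp
    next
      case False
      then have "\<not> p dvd m" using p m by (auto simp: P_def dest!: dvd_imp_le)
      then show ?thesis by (simp add: not_dvd_imp_multiplicity_0)
    qed
  qed (use m in auto)
  have "D \<le> (\<Prod>p\<in>P. (if p \<le> r then r\<^sup>2 else 1) * p)"
    unfolding D_def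
  proof (rule prod_mono, intro conjI)
    fix p assume p: "p \<in> P"
    show "p ^ e p \<le> (if p \<le> r then r\<^sup>2 else 1) * p"
    proof (cases "p \<le> r")
      case True
      then show ?thesis using pow_le[of p] pos[OF p] by (simp add: order_trans[OF _ mult_le_mono2[of 1]])
    next
      case False
      have "e p \<le> 1"
      proof (rule ccontr)
        assume "\<not> e p \<le> 1"
        then have "p ^ 2 \<le> p ^ e p" using pos[OF p] by (intro power_increasing) auto
        moreover have "r\<^sup>2 < p ^ 2" using False by (intro power_strict_mono) auto
        ultimately show False using pow_le[of p] by simp
      qed
      then have "p ^ e p \<le> p ^ 1" using pos[OF p] by (intro power_increasing) auto
      then show ?thesis using False by simp
    qed
  qed simp
  also have "\<dots> = (\<Prod>p\<in>P. if p \<le> r then r\<^sup>2 else 1) * \<Prod>P"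
    by (simp add: prod.distrib)
  also have "(\<Prod>p\<in>P. if p \<le> r then r\<^sup>2 else 1) = (r\<^sup>2) ^ card {p \<in> P. p \<le> r}"
    using finP by (simp add: prod.If_cases Int_def)
  also have "\<dots> \<le> (r\<^sup>2) ^ r"
  proof (rule power_increasing)
    have "card {p \<in> P. p \<le> r} \<le> card {1..r}"
      using pos by (intro card_mono) (auto simp: Suc_le_eq)
    then show "card {p \<in> P. p \<le> r} \<le> r" by simp
  qed (use r in auto)
  also have "\<Prod>P \<le> \<Prod>{p. prime p \<and> p \<le> N}"
  proof (rule dvd_imp_le)
    show "\<Prod>P dvd \<Prod>{p. prime p \<and> p \<le> N}"
      using gap by (intro prod_dvd_prod_subset) (auto simp: P_def)
  qed (auto intro!: prod_pos simp: prime_gt_0_nat)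
  finally show "D \<le> (r\<^sup>2) ^ r * \<Prod>{p. prime p \<and> p \<le> N}"
    by (simp add: mult_right_mono mult_left_mono)
qed

text \<open>
  With \<open>N = 4 ^ j\<close> and \<open>r\<^sup>2 = 4 * N\<close>, a gap would give a common multiple of \<open>{1..4 * N}\<close> that
  is at least \<open>4 ^ (2 * N) / 2\<close> and at most \<open>(4 * N) ^ r * 4 ^ N\<close>. Since \<open>r\<close> is only of order
  \<open>sqrt N\<close>, these contradict each other from \<open>j = 4\<close> on.
\<close>

lemma prime_between_powers_of_4:
  assumes "j \<ge> 4"
  shows "\<exists>p::nat. prime p \<and> 4 ^ j < p \<and> p \<le> 4 ^ Suc j"
proof (rule ccontr)
  assume no: "\<not> ?thesis"
  define r :: nat where "r = 2 ^ Suc j"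
  have r2: "r\<^sup>2 = 4 ^ Suc j"
    unfolding r_def by (simp add: power2_eq_square flip: power_mult_distrib)
  have four: "(4::nat) ^ j = 2 ^ (2 * j)" by (simp add: power_mult)
  obtain D where D: "D > 0" "\<And>m. 1 \<le> m \<Longrightarrow> m \<le> r\<^sup>2 \<Longrightarrow> m dvd D"
    "D \<le> (r\<^sup>2) ^ r * \<Prod>{p. prime p \<and> p \<le> 4 ^ j}"
  proof (rule smooth_common_multiple[of r "4 ^ j"])
    show "p \<le> 4 ^ j" if "prime p" "p \<le> r\<^sup>2" for p
      using no that unfolding r2 by (meson not_less)
  qed (auto simp: r_def)
  have "4 ^ (2 * 4 ^ j) \<le> 2 * D"
    by (rule two_power_le_common_multiple) (use D r2 in auto)
  also have "\<dots> \<le> 2 * ((r\<^sup>2) ^ r * 4 ^ (4 ^ j))"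
    using D(3) prod_primes_le_dyadic[of "2 * j"] unfolding four
    by (meson mult_le_mono2 order_trans)
  also have "\<dots> = 2 ^ (1 + 2 * Suc j * r + 2 * 4 ^ j)"
    unfolding r2 by (simp add: power_add power_mult)
  also have "(4::nat) ^ (2 * 4 ^ j) = 2 ^ (2 * (2 * 4 ^ j))" by (simp add: power_mult)
  finally have "2 * 4 ^ j \<le> 1 + 2 * Suc j * r"
    by (simp only: power_increasing_iff one_less_numeral_iff semiring_norm)
  moreover have "1 + 2 * Suc j * r < 2 * 4 ^ j"
  proof -
    have "2 * Suc j < 2 ^ j"
      using assms by (induction j rule: nat_induct_at_least) auto
    then have "(2 * Suc j + 1) * 2 ^ Suc j \<le> 2 ^ j * 2 ^ Suc j"
      by (intro mult_right_mono) auto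
    also have "\<dots> = (2::nat) * 4 ^ j" by (simp add: four mult_2 power_add distrib_left)
    finally have "2 * Suc j * r + r \<le> 2 * 4 ^ j" by (simp add: r_def algebra_simps)
    moreover have "r > 1" unfolding r_def by (rule one_less_power) auto
    ultimately show ?thesis by linarith
  qed
  ultimately show False by simp
qed

text \<open>
  A weak form of Bertrand's postulate. The ratio 1024 comes from the small values of \<open>N\<close>, where a
  prime between \<open>4 ^ 4\<close> and \<open>4 ^ 5\<close> is used; for larger \<open>N\<close> the ratio is at most 16.
\<close>

lemma prime_within_constant_factor:
  fixes N :: nat
  assumes "N \<ge> 1"
  shows "\<exists>p. prime p \<and> N < p \<and> p \<le> 1024 * N"
proof (cases "N \<le> 4 ^ 4")
  case True
  obtain p :: nat where "prime p" "4 ^ 4 < p" "p \<le> 4 ^ Suc 4"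
    using prime_between_powers_of_4[of 4] by auto
  then show ?thesis using True assms by (intro exI[of _ p]) auto
next
  case False
  define j where "j = (LEAST j. N \<le> 4 ^ j)"
  have "N \<le> 4 ^ N" by (simp add: less_imp_le)
  then have j: "N \<le> 4 ^ j" unfolding j_def by (rule LeastI)
  have "j > 4" using False j by (metis not_less order_trans power_increasing one_le_numeral)
  then obtain i where i: "j = Suc i" "i \<ge> 4" by (cases j) auto
  have "4 ^ i < N" using not_less_Least[of i "\<lambda>j. N \<le> 4 ^ j"] i by (auto simp: j_def[symmetric])
  moreover obtain p :: nat where "prime p" "4 ^ j < p" "p \<le> 4 ^ Suc j"
    using prime_between_powers_of_4[of j] i by auto
  ultimately show ?thesis using i j by (intro exI[of _ p]) auto
qed

section \<open>Roots of integer polynomials modulo a prime\<close>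

text \<open>
  Lagrange's bound on the number of roots over the field with \<open>p\<close> elements, phrased for integer
  polynomials: splitting off the linear factor of a root \<open>a\<close> leaves the constant \<open>poly F a\<close>, which
  is divisible by \<open>p\<close>, and the quotient keeps the other roots because \<open>b - a\<close> is invertible
  modulo \<open>p\<close>.
\<close>

lemma const_prime_dvd_poly_of_roots:
  fixes F :: "int poly" and p :: int
  assumes "prime p" "finite A"
    and "inj_on (\<lambda>x. x mod p) A"
    and "\<And>a. a \<in> A \<Longrightarrow> p dvd poly F a"
    and "F = 0 \<or> Polynomial.degree F < card A"
  shows "[:p:] dvd F"
  using assms(2-)
proof (induction A arbitrary: F rule: finite_induct)
  case empty
  then show ?case by simp
next
  case (insert a A)
  define G where "G = synthetic_div F a"
  have F: "F = [:-a, 1:] * G + [:poly F a:]"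
    by (simp only: G_def synthetic_div_correct')
  have "p dvd poly G b" if b: "b \<in> A" for b
  proof -
    have "poly F b = (b - a) * poly G b + poly F a"
      by (subst F) (simp add: algebra_simps)
    then have "p dvd (b - a) * poly G b + poly F a"
      using insert.prems(2)[of b] b by simp
    then have "p dvd (b - a) * poly G b"
      using insert.prems(2)[of a] by (simp add: dvd_add_left_iff)
    moreover have "\<not> p dvd b - a"
    proof -
      have "b mod p \<noteq> a mod p"
        using insert.prems(1) insert.hyps(2) b by (auto simp: inj_on_def)
      then show ?thesis by (simp add: mod_eq_dvd_iff)
    qed
    ultimately show ?thesis
      using \<open>prime p\<close> by (simp add: prime_dvd_mult_iff)
  qed
  moreover have "G = 0 \<or> Polynomial.degree G < card A"
  proof (cases "Polynomial.degree F = 0")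
    case True
    then show ?thesis by (simp add: G_def synthetic_div_eq_0_iff)
  next
    case False
    then have "Polynomial.degree F < Suc (card A)"
      using insert.prems(3) insert.hyps by auto
    then show ?thesis
      using False unfolding G_def degree_synthetic_div by linarith
  qed
  ultimately have "[:p:] dvd G"
    using insert.IH insert.prems(1) by simp
  moreover have "[:p:] dvd [:poly F a:]"
    using insert.prems(2)[of a] by simp
  ultimately show ?case by (subst F) (intro dvd_add dvd_mult)
qed

section \<open>Evaluation homomorphisms to finite affine groups\<close>

lemma group_semidirect_product:
  assumes "group N" "group H"
    and act: "\<And>s. s \<in> carrier H \<Longrightarrow> act s \<in> hom N N"
    and act_mult: "\<And>s t x. \<lbrakk>s \<in> carrier H; t \<in> carrier H; x \<in> carrier N\<rbrakk> \<Longrightarrow>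
      act (s \<otimes>\<^bsub>H\<^esub> t) x = act s (act t x)"
    and act_one: "\<And>x. x \<in> carrier N \<Longrightarrow> act \<one>\<^bsub>H\<^esub> x = x"
  shows "group (semidirect_product N H act)"
proof -
  interpret N: group N by fact
  interpret H: group H by fact
  have act_closed: "act s x \<in> carrier N" if "s \<in> carrier H" "x \<in> carrier N" for s x
    using act that by (auto simp: hom_def)
  have act_hom: "act s (x \<otimes>\<^bsub>N\<^esub> y) = act s x \<otimes>\<^bsub>N\<^esub> act s y"
    if "s \<in> carrier H" "x \<in> carrier N" "y \<in> carrier N" for s x y
    using act that by (auto simp: hom_def)
  show ?thesis
  proof (rule groupI)
    fix x assume "x \<in> carrier (semidirect_product N H act)"
    then obtain a s where x: "x = (a, s)" "a \<in> carrier N" "s \<in> carrier H"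
      by (auto simp: semidirect_product_def)
    show "\<exists>y\<in>carrier (semidirect_product N H act).
      y \<otimes>\<^bsub>semidirect_product N H act\<^esub> x = \<one>\<^bsub>semidirect_product N H act\<^esub>"
      by (rule bexI[of _ "(act (inv\<^bsub>H\<^esub> s) (inv\<^bsub>N\<^esub> a), inv\<^bsub>H\<^esub> s)"])
        (use x in \<open>simp_all add: semidirect_product_def act_closed flip: act_hom,
          simp add: group_hom.hom_one[of N N] group_hom_def group_hom_axioms_def
            act \<open>group N\<close>\<close>)
  qed (auto simp: semidirect_product_def act_closed act_hom act_mult act_one N.m_assoc H.m_assoc
        intro: act_closed)
qed

lemma order_semidirect_product:
  "order (semidirect_product N H act) = order N * order H"
  by (simp add: Coset.order_def semidirect_product_def card_cartesian_product)

lemma order_integer_mod_group: "order (integer_mod_group n) = n"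
  by (simp add: Coset.order_def carrier_integer_mod_group)

text \<open>
  If \<open>a ^ m\<close> is 1 modulo \<open>p\<close>, this is the power \<open>a ^ t\<close> modulo \<open>p\<close> for an integer exponent \<open>t\<close>:
  reducing the exponent modulo \<open>m\<close> first avoids inverses of \<open>a\<close>.
\<close>

definition cyclic_power :: "nat \<Rightarrow> int \<Rightarrow> int \<Rightarrow> int" where
  "cyclic_power m a t = a ^ nat (t mod int m)"

lemma cyclic_power_mod [simp]: "cyclic_power m a (t mod int m) = cyclic_power m a t"
  by (simp add: cyclic_power_def)

lemma cyclic_power_add:
  assumes "[a ^ m = 1] (mod p)" "m > 0"
  shows "[cyclic_power m a (s + t) = cyclic_power m a s * cyclic_power m a t] (mod p)"
proof -
  define i j where "i = nat (s mod int m)" and "j = nat (t mod int m)"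
  have "nat ((s + t) mod int m) = nat ((s mod int m + t mod int m) mod int m)"
    by (simp add: mod_add_eq)
  also have "\<dots> = nat (int (i + j) mod int m)"
    using assms(2) by (simp add: i_def j_def)
  also have "\<dots> = (i + j) mod m" by (simp only: nat_int flip: of_nat_mod)
  finally have ij: "cyclic_power m a (s + t) = a ^ ((i + j) mod m)"
    by (simp add: cyclic_power_def)
  have "[a ^ (m * ((i + j) div m) + (i + j) mod m) = 1 ^ ((i + j) div m) * a ^ ((i + j) mod m)] (mod p)"
    unfolding power_add power_mult by (intro cong_mult cong_pow assms(1) cong_refl)
  then have "[a ^ (i + j) = a ^ ((i + j) mod m)] (mod p)" by simp
  then show ?thesis
    unfolding ij by (simp add: cong_sym cyclic_power_def power_add i_def j_def)
qed

text \<open>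
  For \<open>a ^ m\<close> equal to 1 modulo \<open>p\<close>, the pair \<open>(x, s)\<close> acts as the affine map
  \<open>y \<mapsto> x + a ^ s * y\<close> on the integers modulo \<open>p\<close>. The exponent \<open>s\<close> is kept instead of \<open>a ^ s\<close>,
  so that the order is always \<open>p * m\<close>, whatever the order of \<open>a\<close>.
\<close>

definition affine_mod_group :: "nat \<Rightarrow> nat \<Rightarrow> int \<Rightarrow> (int \<times> int) monoid" where
  "affine_mod_group p m a = semidirect_product (integer_mod_group p) (integer_mod_group m)
     (\<lambda>s x. cyclic_power m a s * x mod int p)"

lemma group_affine_mod_group:
  assumes "[a ^ m = 1] (mod int p)" "m > 0" "p > 0"
  shows "group (affine_mod_group p m a)"
  unfolding affine_mod_group_def
proof (rule group_semidirect_product)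
  fix s t x assume "s \<in> carrier (integer_mod_group m)" "t \<in> carrier (integer_mod_group m)"
    "x \<in> carrier (integer_mod_group p)"
  have "[cyclic_power m a (s + t) * x = cyclic_power m a s * cyclic_power m a t * x] (mod int p)"
    using cyclic_power_add[OF assms(1,2)] by (rule cong_scalar_right)
  then show "cyclic_power m a (s \<otimes>\<^bsub>integer_mod_group m\<^esub> t) * x mod int p =
    cyclic_power m a s * (cyclic_power m a t * x mod int p) mod int p"
    by (simp add: cong_def mod_mult_right_eq mult.assoc)
next
  fix x assume "x \<in> carrier (integer_mod_group p)"
  then show "cyclic_power m a \<one>\<^bsub>integer_mod_group m\<^esub> * x mod int p = x"
    using assms by (simp add: cyclic_power_def carrier_integer_mod_group)
qed (use assms in \<open>auto simp: hom_def carrier_integer_mod_group mod_add_eq mod_mult_right_eq distrib_left\<close>)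

text \<open>
  With \<open>e i = a ^ i\<close>, this is the value at \<open>a\<close> of the Laurent polynomial with coefficients \<open>f\<close>.
\<close>

definition evaluate :: "(int \<Rightarrow> int) \<Rightarrow> (int \<Rightarrow> int) \<Rightarrow> int" where
  "evaluate e f = (\<Sum>i | f i \<noteq> 0. f i * e i)"

lemma evaluate_superset:
  assumes "finite A" "{i. f i \<noteq> 0} \<subseteq> A"
  shows "evaluate e f = (\<Sum>i\<in>A. f i * e i)"
  unfolding evaluate_def using assms by (intro sum.mono_neutral_left) auto

lemma evaluate_add:
  assumes "finite {i. f i \<noteq> 0}" "finite {i. g i \<noteq> 0}"
  shows "evaluate e (\<lambda>i. f i + g i) = evaluate e f + evaluate e g"
proof -
  let ?A = "{i. f i \<noteq> 0} \<union> {i. g i \<noteq> 0}"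
  have "evaluate e h = (\<Sum>i\<in>?A. h i * e i)" if "{i. h i \<noteq> 0} \<subseteq> ?A" for h
    using assms that by (intro evaluate_superset) auto
  from this[of f] this[of g] this[of "\<lambda>i. f i + g i"] show ?thesis
    by (auto simp: distrib_right sum.distrib subset_iff)
qed

lemma evaluate_shift:
  "evaluate e (\<lambda>i. f (i - s)) = evaluate (\<lambda>i. e (s + i)) f"
  unfolding evaluate_def
  by (rule sum.reindex_bij_witness[of _ "\<lambda>i. s + i" "\<lambda>i. i - s"]) auto

text \<open>
  The base group is the additive group of Laurent polynomials, on which the generator of the
  acting group multiplies by the variable. Evaluation at \<open>a\<close> turns this into multiplication
  by \<open>a\<close>, so it extends to a homomorphism into the affine group.
\<close>

lemma evaluate_hom:
  assumes "[a ^ m = 1] (mod int p)" "m > 0" "p > 0"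
  shows "(\<lambda>(f, t). (evaluate (cyclic_power m a) f mod int p, t mod int m))
    \<in> hom Z_wr_Z (affine_mod_group p m a)"
proof (rule homI)
  fix x y assume "x \<in> carrier Z_wr_Z" "y \<in> carrier Z_wr_Z"
  then obtain f s g t where xy: "x = (f, s)" "y = (g, t)"
    and fin: "finite {i. f i \<noteq> 0}" "finite {i. g i \<noteq> 0}"
    by (auto simp: carrier_Z_wr_Z)
  let ?e = "cyclic_power m a"
  have "[evaluate (\<lambda>i. ?e (s + i)) g = (\<Sum>i | g i \<noteq> 0. g i * (?e s * ?e i))] (mod int p)"
    unfolding evaluate_def
    by (intro cong_sum cong_scalar_left cyclic_power_add assms)
  also have "(\<Sum>i | g i \<noteq> 0. g i * (?e s * ?e i)) = ?e s * evaluate ?e g"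
    by (simp add: evaluate_def sum_distrib_left ac_simps)
  finally have "[evaluate ?e (\<lambda>i. f i + g (i - s)) = evaluate ?e f + ?e s * evaluate ?e g] (mod int p)"
    using fin by (simp add: evaluate_add finite_support_shift evaluate_shift cong_add_lcancel)
  moreover have "(u + v * (w mod int p)) mod int p = (u + v * w) mod int p" for u v w
    by (metis mod_add_right_eq mod_mult_right_eq)
  ultimately show "(case x \<otimes>\<^bsub>Z_wr_Z\<^esub> y of (f, t) \<Rightarrow> (evaluate ?e f mod int p, t mod int m)) =
    (case x of (f, t) \<Rightarrow> (evaluate ?e f mod int p, t mod int m)) \<otimes>\<^bsub>affine_mod_group p m a\<^esub>
    (case y of (f, t) \<Rightarrow> (evaluate ?e f mod int p, t mod int m))"
    by (simp add: xy mult_Z_wr_Z affine_mod_group_def semidirect_product_def cong_def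
      mod_simps)
qed (use assms in \<open>auto simp: affine_mod_group_def semidirect_product_def carrier_integer_mod_group\<close>)

section \<open>Support and height of short words\<close>

text \<open>
  One bound for the shift, the support and the coefficients together: these are the quantities
  that grow at most linearly with the length of a word.
\<close>

definition in_box :: "nat \<Rightarrow> (int \<Rightarrow> int) \<times> int \<Rightarrow> bool" where
  "in_box B x \<longleftrightarrow> \<bar>snd x\<bar> \<le> int B \<and> (\<forall>i. fst x i \<noteq> 0 \<longrightarrow> \<bar>i\<bar> \<le> int B \<and> \<bar>fst x i\<bar> \<le> int B)"

lemma in_box_mono: "in_box B x \<Longrightarrow> B \<le> C \<Longrightarrow> in_box C x"
  unfolding in_box_def by (meson of_nat_le_iff order_trans)

text \<open>
  Additivity of the bounds: in the product the second function is displaced by the shift of the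
  first factor, which moves its support by at most \<open>B\<close>.
\<close>

lemma in_box_mult:
  assumes "in_box B x" "in_box C y"
  shows "in_box (B + C) (x \<otimes>\<^bsub>Z_wr_Z\<^esub> y)"
proof -
  obtain f s g t where xy: "x = (f, s)" "y = (g, t)" by (metis surj_pair)
  have f: "\<bar>s\<bar> \<le> int B" "f i \<noteq> 0 \<Longrightarrow> \<bar>i\<bar> \<le> int B" "\<bar>f i\<bar> \<le> int B" for i
    using assms(1) by (cases "f i = 0"; simp add: in_box_def xy)+
  have g: "\<bar>t\<bar> \<le> int C" "g i \<noteq> 0 \<Longrightarrow> \<bar>i\<bar> \<le> int C" "\<bar>g i\<bar> \<le> int C" for i
    using assms(2) by (cases "g i = 0"; simp add: in_box_def xy)+
  have "\<bar>i\<bar> \<le> int B + int C" if "f i + g (i - s) \<noteq> 0" for i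
    using that f(1) f(2)[of i] g(2)[of "i - s"] by (cases "f i = 0"; cases "g (i - s) = 0") auto
  moreover have "\<bar>f i + g (i - s)\<bar> \<le> int B + int C" for i
    using f(3)[of i] g(3)[of "i - s"] by linarith
  ultimately show ?thesis
    using f(1) g(1) by (simp add: in_box_def xy mult_Z_wr_Z)
qed

lemma in_box_exists:
  assumes "x \<in> carrier Z_wr_Z"
  shows "\<exists>B. in_box B x"
proof -
  obtain f s where x: "x = (f, s)" and fin: "finite {i. f i \<noteq> 0}"
    using assms by (auto simp: carrier_Z_wr_Z)
  define B where "B = nat \<bar>s\<bar> + (\<Sum>i | f i \<noteq> 0. nat \<bar>i\<bar> + nat \<bar>f i\<bar>)"
  have "nat \<bar>i\<bar> + nat \<bar>f i\<bar> \<le> (\<Sum>i | f i \<noteq> 0. nat \<bar>i\<bar> + nat \<bar>f i\<bar>)" if "f i \<noteq> 0" for i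
    using fin that by (intro member_le_sum) auto
  then have "nat \<bar>i\<bar> + nat \<bar>f i\<bar> \<le> B" if "f i \<noteq> 0" for i
    using that by (fastforce simp: B_def)
  then have "\<bar>i\<bar> \<le> int B \<and> \<bar>f i\<bar> \<le> int B" if "f i \<noteq> 0" for i
    using that by fastforce
  moreover have "\<bar>s\<bar> \<le> int B" by (simp add: B_def sum_nonneg)
  ultimately have "in_box B x"
    unfolding in_box_def by (simp add: x)
  then show ?thesis ..
qed

lemma finite_common_box:
  assumes "finite T" "T \<subseteq> carrier Z_wr_Z"
  shows "\<exists>B. \<forall>x\<in>T. in_box B x"
  using assms
proof (induction T rule: finite_induct)
  case (insert x T)
  then obtain B where "\<forall>x\<in>T. in_box B x" by auto
  moreover obtain B' where "in_box B' x" using in_box_exists insert.prems by blast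
  ultimately have "\<forall>y\<in>insert x T. in_box (max B B') y"
    by (auto intro: in_box_mono)
  then show ?case ..
qed simp

lemma in_box_word_product:
  assumes "\<And>x. x \<in> set ws \<Longrightarrow> in_box B x"
  shows "in_box (length ws * B) (word_product Z_wr_Z ws)"
  using assms
proof (induction ws)
  case Nil
  show ?case by (simp add: word_product_def in_box_def one_Z_wr_Z)
next
  case (Cons x ws)
  then have "in_box (B + length ws * B) (x \<otimes>\<^bsub>Z_wr_Z\<^esub> word_product Z_wr_Z ws)"
    by (intro in_box_mult) auto
  then show ?case by (simp add: word_product_def)
qed

lemma in_box_word_norm:
  assumes "finite S" "generating_set Z_wr_Z S"
  shows "\<exists>C. \<forall>g\<in>carrier Z_wr_Z. \<forall>n. word_norm Z_wr_Z S g \<le> n \<longrightarrow> in_box (n * C) g"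
proof -
  interpret group Z_wr_Z by (rule group_Z_wr_Z)
  let ?T = "S \<union> m_inv Z_wr_Z ` S"
  have "?T \<subseteq> carrier Z_wr_Z" using assms(2) by (auto simp: generating_set_def)
  then obtain C where C: "\<forall>x\<in>?T. in_box C x"
    using finite_common_box[of ?T] assms(1) by auto
  have "in_box (n * C) g" if g: "g \<in> carrier Z_wr_Z" "word_norm Z_wr_Z S g \<le> n" for g n
  proof -
    have "\<exists>k ws. length ws = k \<and> set ws \<subseteq> ?T \<and> word_product Z_wr_Z ws = g"
      using generating_set_word_exists[OF group_Z_wr_Z assms(2) g(1)] by blast
    then have "\<exists>ws. length ws = word_norm Z_wr_Z S g \<and> set ws \<subseteq> ?T \<and> word_product Z_wr_Z ws = g"
      unfolding word_norm_def by (rule LeastI_ex)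
    then obtain ws where ws: "length ws = word_norm Z_wr_Z S g" "set ws \<subseteq> ?T"
      "word_product Z_wr_Z ws = g" by blast
    then have "in_box (length ws * C) g"
      using in_box_word_product[of ws C] C by auto
    then show ?thesis using ws(1) g(2) by (auto elim: in_box_mono intro: mult_right_mono)
  qed
  then show ?thesis by blast
qed

section \<open>Small quotients detecting an element\<close>

text \<open>
  Multiplied by the \<open>B\<close>-th power of the variable, \<open>f\<close> becomes a polynomial of degree at most
  \<open>2 * B\<close>. It is nonzero modulo \<open>p\<close>, as its coefficients are smaller than \<open>p\<close>, so it cannot vanish at
  all \<open>p - 1 > 2 * B\<close> units modulo \<open>p\<close>.
\<close>

lemma exists_unit_evaluate_nonzero:
  assumes p: "prime p" and B: "2 * B + 1 < p"
    and f: "in_box B (f, 0)" "f k \<noteq> 0"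
  obtains a where "[a ^ (p - 1) = 1] (mod int p)"
    "\<not> int p dvd evaluate (cyclic_power (p - 1) a) f"
proof -
  define F :: "int poly" where "F = (\<Sum>j\<le>2 * B. Polynomial.monom (f (int j - int B)) j)"
  let ?A = "int ` {1..<p}"
  have supp: "\<bar>i\<bar> \<le> int B" if "f i \<noteq> 0" for i using f(1) that by (simp add: in_box_def)
  then have supp': "{i. f i \<noteq> 0} \<subseteq> {- int B..int B}" by (fastforce simp: abs_le_iff)
  have coeff_F: "Polynomial.coeff F j = (if j \<le> 2 * B then f (int j - int B) else 0)" for j
    by (simp add: F_def coeff_sum)
  have "Polynomial.coeff F (nat (k + int B)) = f k"
    using supp[of k] f(2) by (auto simp: coeff_F)
  moreover have "\<not> int p dvd f k"
    using f B dvd_imp_le_int[of "f k" "int p"] by (auto simp: in_box_def)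
  ultimately have ndvd: "\<not> [:int p:] dvd F"
    by (metis const_poly_dvd_iff)
  have "Polynomial.degree F \<le> 2 * B" by (rule degree_le) (simp add: coeff_F)
  then have deg: "Polynomial.degree F < card ?A"
    using B by (simp add: card_image)
  have "inj_on (\<lambda>x. x mod int p) ?A" by (auto simp: inj_on_def simp flip: of_nat_mod)
  then have "\<not> (\<forall>a\<in>?A. int p dvd poly F a)"
    using const_prime_dvd_poly_of_roots[of "int p" ?A F] ndvd deg p by auto
  then obtain a where a: "a \<in> {1..<p}" "\<not> int p dvd poly F (int a)"
    by blast
  have "\<not> p dvd a" using a(1) by (auto dest: dvd_imp_le)
  then have "[a ^ (p - 1) = 1] (mod p)" using p by (intro fermat_theorem)
  then have fermat: "[int a ^ (p - 1) = 1] (mod int p)"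
    by (metis cong_int_iff of_nat_1 of_nat_power)
  \<comment> \<open>The exponents \<open>j \<le> 2 * B\<close> lie below \<open>p - 1\<close>, so there \<open>cyclic_power\<close> is the ordinary power.\<close>
  let ?e = "cyclic_power (p - 1) (int a)"
  have "poly F (int a) = (\<Sum>j\<le>2 * B. f (int j - int B) * int a ^ j)"
    by (simp add: F_def poly_sum poly_monom)
  also have "\<dots> = (\<Sum>j\<le>2 * B. f (int j - int B) * ?e (int B + (int j - int B)))"
    using B by (intro sum.cong) (auto simp: cyclic_power_def)
  also have "\<dots> = (\<Sum>i\<in>{- int B..int B}. f i * ?e (int B + i))"
    by (rule sum.reindex_bij_witness[of _ "\<lambda>i. nat (i + int B)" "\<lambda>j. int j - int B"]) auto
  also have "[\<dots> = (\<Sum>i\<in>{- int B..int B}. f i * (?e (int B) * ?e i))] (mod int p)"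
    using B by (intro cong_sum cong_scalar_left cyclic_power_add fermat) auto
  also have "(\<Sum>i\<in>{- int B..int B}. f i * (?e (int B) * ?e i)) = ?e (int B) * evaluate ?e f"
    by (subst evaluate_superset[OF _ supp']) (auto simp: sum_distrib_left ac_simps)
  finally have "\<not> int p dvd ?e (int B) * evaluate ?e f"
    using a(2) by (simp add: cong_dvd_iff)
  then show thesis using fermat that by (meson dvd_mult)
qed

lemma shift_detecting_order:
  assumes "(f, s) \<in> carrier Z_wr_Z" "s \<noteq> 0"
  shows "nat \<bar>s\<bar> + 1 \<in> detecting_orders Z_wr_Z (f, s)"
proof -
  let ?m = "nat \<bar>s\<bar> + 1"
  have "(\<lambda>(f, t). t mod int ?m) \<in> hom Z_wr_Z (integer_mod_group ?m)"
    by (rule homI) (auto simp: carrier_integer_mod_group mult_Z_wr_Z mod_simps)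
  moreover have "s mod int ?m \<noteq> 0"
    using assms(2) zdvd_imp_le[of "int ?m" "\<bar>s\<bar>"] by (auto simp: mod_eq_0_iff_dvd)
  ultimately show ?thesis
    using detecting_ordersI[of "integer_mod_group ?m" "\<lambda>(f, t). t mod int ?m" Z_wr_Z "(f, s)"] assms(1)
    by (simp add: order_integer_mod_group carrier_integer_mod_group)
qed

lemma base_detecting_order:
  assumes p: "prime p" and B: "2 * B + 1 < p"
    and f: "(f, 0) \<in> carrier Z_wr_Z" "in_box B (f, 0)" "f \<noteq> (\<lambda>_. 0)"
  shows "p * (p - 1) \<in> detecting_orders Z_wr_Z (f, 0)"
proof -
  obtain k where k: "f k \<noteq> 0" using f(3) by auto
  obtain a where a: "[a ^ (p - 1) = 1] (mod int p)"
    "\<not> int p dvd evaluate (cyclic_power (p - 1) a) f"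
    using exists_unit_evaluate_nonzero[OF p B f(2) k] by blast
  let ?Q = "affine_mod_group p (p - 1) a"
  let ?\<phi> = "\<lambda>(f, t). (evaluate (cyclic_power (p - 1) a) f mod int p, t mod int (p - 1))"
  have pos: "p - 1 > 0" "p > 0" using B by auto
  have "order ?Q \<in> detecting_orders Z_wr_Z (f, 0)"
  proof (rule detecting_ordersI)
    show "group ?Q" by (rule group_affine_mod_group) fact+
    show "?\<phi> \<in> hom Z_wr_Z ?Q" by (rule evaluate_hom) fact+
    show "?\<phi> (f, 0) \<noteq> \<one>\<^bsub>?Q\<^esub>"
      using a(2) by (simp add: affine_mod_group_def semidirect_product_def mod_eq_0_iff_dvd)
    show "finite (carrier ?Q)"
      using pos by (simp add: affine_mod_group_def semidirect_product_def carrier_integer_mod_group)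
  qed fact
  then show ?thesis
    by (simp add: affine_mod_group_def order_semidirect_product order_integer_mod_group)
qed

lemma small_detecting_order:
  assumes g: "g \<in> carrier Z_wr_Z" "g \<noteq> \<one>\<^bsub>Z_wr_Z\<^esub>" and box: "in_box B g"
  shows "\<exists>q\<in>detecting_orders Z_wr_Z g. q \<le> (1024 * (2 * B + 1))\<^sup>2"
proof -
  obtain f s where [simp]: "g = (f, s)" by (metis surj_pair)
  show ?thesis
  proof (cases "s = 0")
    case True
    obtain p where p: "prime p" "2 * B + 1 < p" "p \<le> 1024 * (2 * B + 1)"
      using prime_within_constant_factor[of "2 * B + 1"] by auto
    have "p * (p - 1) \<in> detecting_orders Z_wr_Z g"
      using base_detecting_order[OF p(1,2), of f] g box True by (auto simp: one_Z_wr_Z)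
    moreover have "p * (p - 1) \<le> (1024 * (2 * B + 1))\<^sup>2"
      unfolding power2_eq_square using p(3) by (intro mult_le_mono) auto
    ultimately show ?thesis by blast
  next
    case False
    have "nat \<bar>s\<bar> + 1 \<in> detecting_orders Z_wr_Z g"
      using shift_detecting_order[of f s] g False by simp
    moreover have "nat \<bar>s\<bar> + 1 \<le> 1024 * (2 * B + 1)"
      using box by (auto simp: in_box_def nat_le_iff)
    then have "nat \<bar>s\<bar> + 1 \<le> (1024 * (2 * B + 1))\<^sup>2"
      by (rule order_trans) (simp only: power2_eq_square le_square)
    ultimately show ?thesis by blast
  qed
qed

lemma Rf_le:
  assumes "group G" "generating_set G S" "finite S"
    and "\<And>g. \<lbrakk>g \<in> carrier G; g \<noteq> \<one>\<^bsub>G\<^esub>; word_norm G S g \<le> n\<rbrakk> \<Longrightarrow>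
      \<exists>q\<in>detecting_orders G g. q \<le> b"
  shows "Rf G S n \<le> b"
proof -
  have "finite {g \<in> carrier G - {\<one>\<^bsub>G\<^esub>}. word_norm G S g \<le> n}"
    by (rule finite_subset[OF _ finite_word_norm_ball[OF assms(1-3), of n]]) auto
  moreover have "(LEAST q. q \<in> detecting_orders G g) \<le> b"
    if g: "g \<in> carrier G - {\<one>\<^bsub>G\<^esub>}" "word_norm G S g \<le> n" for g
  proof -
    obtain q where "q \<in> detecting_orders G g" "q \<le> b"
      using assms(4)[of g] g by auto
    then show ?thesis by (meson Least_le order_trans)
  qed
  ultimately show ?thesis unfolding Rf_def by (subst Max_le_iff) auto
qed

theorem theorem5:
  fixes S :: "((int \<Rightarrow> int) \<times> int) set"
  assumes "finite S" and "generating_set Z_wr_Z S"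
  shows "\<exists>c::real. c > 0 \<and> (\<forall>n::nat. n \<ge> 1 \<longrightarrow> real (Rf Z_wr_Z S n) \<le> c * (real n)\<^sup>2)"
proof -
  obtain C where C: "\<And>g n. \<lbrakk>g \<in> carrier Z_wr_Z; word_norm Z_wr_Z S g \<le> n\<rbrakk> \<Longrightarrow> in_box (n * C) g"
    using in_box_word_norm[OF assms] by blast
  define c where "c = 1024 * (2 * C + 1)"
  have "real (Rf Z_wr_Z S n) \<le> (real c)\<^sup>2 * (real n)\<^sup>2" if n: "n \<ge> 1" for n
  proof -
    have "Rf Z_wr_Z S n \<le> (1024 * (2 * (n * C) + 1))\<^sup>2"
      by (rule Rf_le[OF group_Z_wr_Z assms(2,1)]) (rule small_detecting_order, auto intro: C)
    also have "\<dots> \<le> (c * n)\<^sup>2"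
      using n by (intro power_mono) (auto simp: c_def algebra_simps)
    finally have "real (Rf Z_wr_Z S n) \<le> real ((c * n)\<^sup>2)" by (simp only: of_nat_le_iff)
    then show ?thesis by (simp add: power_mult_distrib)
  qed
  moreover have "(real c)\<^sup>2 > 0" by (simp add: c_def)
  ultimately show ?thesis by blast
qed

end
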